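(* Let $\Gamma$, $C=(c_{ij})_{i,j\in I}$ be arbitrary, associated to a Coxeter group $W$ as described in the context, and let $v\in\mathbb{R}^I$. Then $v$ can reach a forbidden configuration by playing the (weighted) numbers game if and only if there exist $\beta\in\Delta_+$ and $i\in I$ such that both $\beta\cdot v<-1$ and $\beta\ge\alpha_i$. In this case, the minimum number of moves required to reach a forbidden configuration is $$m'(v):=\min\{\mathrm{dp}(\beta)-1\mid \beta\in\Delta_+,\ \beta\cdot v<-1,\ \text{and there exists } i\in I \text{ with } \beta\ge\alpha_i\}.$$ Moreover, in this case, if $i\in I$ is such that $v_i<0$, then $m'(f_iv)\ge m'(v)-1$ (provided $m'(f_iv)$ is defined, i.e., $f_iv$ can reach a forbidden configuration).
   Context: Setting: $\Gamma$ is a finite graph with vertex set $I$, without loops or multiple edges. $W$ is the Coxeter group with generators $s_i$ ($i\in I$) and relations $(s_is_j)^{n_{ij}}=1$, where $n_{ii}=1$, $n_{ij}=n_{ji}\in\{2,3,\dots\}\cup\{\infty\}$ for $i\ne j$ (no relation if $n_{ij}=\infty$), and distinct $i,j$ are adjacent in $\Gamma$ exactly when $n_{ij}\geq3$. $C=(c_{ij})$ is a real matrix with $c_{ii}=2$ for all $i$, $c_{ij}=0$ whenever $i\ne j$ are not adjacent, and for adjacent $i,j$: $c_{ij},c_{ji}<0$ and either $c_{ij}c_{ji}=4\cos^2(\pi/n_{ij})$ if $n_{ij}$ is finite, or $c_{ij}c_{ji}\ge4$ if $n_{ij}=\infty$. Weighted numbers game: configurations are $v\in\mathbb{R}^I$;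 if $v_i<0$ one may fire $i$, replacing $v$ by $f_i(v)$ with $f_i(v)_j=v_j-c_{ij}v_i$. A configuration is forbidden if some $v_i<-1$. A configuration which is itself forbidden reaches a forbidden configuration in $0$ moves. $W$ acts on $\mathbb{R}^I$ (basis of elementary vectors $\alpha_i$, the simple roots) by $s_i(\beta)_j=\beta_j$ for $j\ne i$ and $s_i(\beta)_i=-\beta_i-\sum_{k\ne i}c_{ik}\beta_k$. The set of (real) roots is $\Delta=\bigcup_{i\in I}W\alpha_i$, and $\Delta_+$ is the set of roots all of whose entries are nonnegative; one has $\Delta=\Delta_+\sqcup(-\Delta_+)$. Partial order on $\Delta_+$: for $\beta, s_i\beta\in\Delta_+$, $\beta<s_i\beta$ if and only if $\beta_i<(s_i\beta)_i$; in general $\alpha<\beta$ if there is a sequence $\alpha<s_{i_1}\alpha<s_{i_2}s_{i_1}\alpha<\cdots<s_{i_m}\cdots s_{i_1}\alpha=\beta$ (with $m\ge1$); and $\alpha\le\beta$ means $\alpha<\beta$ or $\alpha=\beta$. The depth $\mathrm{dp}(\beta)$ of $\beta\in\Delta_+$ is the minimum number of simple reflections required to take $\beta$ to a negative root; $\alpha<s_i\alpha$ implies $\mathrm{dp}(s_i\alpha)=\mathrm{dp}(\alpha)+1$. The symbol $\cdot$ is the standard dot product on $\mathbb{R}^I$. *)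

theory Defs
  imports "HOL-Analysis.Analysis" "HOL-Library.Extended_Nat"
begin

text \<open>The vertex set of the graph is a finite type \<open>'i\<close>; the matrix entry \<open>c\<^sub>i\<^sub>j\<close> is \<open>C $ i $ j\<close>.\<close>

locale weighted_coxeter_graph =
  fixes adj :: "'i::finite \<Rightarrow> 'i \<Rightarrow> bool"
    and n :: "'i \<Rightarrow> 'i \<Rightarrow> enat"
    and C :: "real ^ 'i ^ 'i"
  assumes n_diag: "n i i = 1"
    and n_sym: "n i j = n j i"
    and n_ge_2: "i \<noteq> j \<Longrightarrow> 2 \<le> n i j"
    and adj_iff: "adj i j \<longleftrightarrow> i \<noteq> j \<and> 3 \<le> n i j"
    and C_diag: "C $ i $ i = 2"
    and C_nonadj: "i \<noteq> j \<Longrightarrow> \<not> adj i j \<Longrightarrow> C $ i $ j = 0"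
    and C_neg: "adj i j \<Longrightarrow> C $ i $ j < 0"
    and C_finite: "adj i j \<Longrightarrow> n i j = enat m \<Longrightarrow>
          C $ i $ j * C $ j $ i = 4 * (cos (pi / real m))\<^sup>2"
    and C_infinite: "adj i j \<Longrightarrow> n i j = \<infinity> \<Longrightarrow> C $ i $ j * C $ j $ i \<ge> 4"

subsection \<open>The weighted numbers game\<close>

definition fire :: "real ^ 'i ^ 'i \<Rightarrow> 'i::finite \<Rightarrow> real ^ 'i \<Rightarrow> real ^ 'i" where
  "fire C i v = (\<chi> j. v $ j - C $ i $ j * v $ i)"

definition legal_move :: "real ^ 'i ^ 'i \<Rightarrow> real ^ 'i \<Rightarrow> real ^ 'i::finite \<Rightarrow> bool" where
  "legal_move C v w \<longleftrightarrow> (\<exists>i. v $ i < 0 \<and> w = fire C i v)"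

definition forbidden :: "real ^ 'i::finite \<Rightarrow> bool" where
  "forbidden v \<longleftrightarrow> (\<exists>i. v $ i < -1)"

definition can_reach_forbidden :: "real ^ 'i ^ 'i \<Rightarrow> real ^ 'i::finite \<Rightarrow> bool" where
  "can_reach_forbidden C v \<longleftrightarrow> (\<exists>w. (legal_move C)\<^sup>*\<^sup>* v w \<and> forbidden w)"

text \<open>Meaningful only if \<open>can_reach_forbidden C v\<close> holds.\<close>

definition min_moves_to_forbidden :: "real ^ 'i ^ 'i \<Rightarrow> real ^ 'i::finite \<Rightarrow> nat" where
  "min_moves_to_forbidden C v = (LEAST k. \<exists>w. (legal_move C ^^ k) v w \<and> forbidden w)"

subsection \<open>Roots\<close>

definition simple_root :: "'i::finite \<Rightarrow> real ^ 'i" where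
  "simple_root i = axis i 1"

definition simple_reflection :: "real ^ 'i ^ 'i \<Rightarrow> 'i::finite \<Rightarrow> real ^ 'i \<Rightarrow> real ^ 'i" where
  "simple_reflection C i \<beta> =
     (\<chi> j. if j = i then - (\<beta> $ i) - (\<Sum>k\<in>UNIV - {i}. C $ i $ k * \<beta> $ k) else \<beta> $ j)"

text \<open>
  The generators of the Coxeter group \<open>W\<close> are involutions, so every element of \<open>W\<close> is
  represented by a word in the generators.  The word \<open>[i\<^sub>1, \<dots>, i\<^sub>m]\<close> stands for
  \<open>s\<^sub>i\<^sub>1 \<cdots> s\<^sub>i\<^sub>m\<close>, and the \<open>W\<close>-orbit of a vector is its orbit under all words.
\<close>

definition word_action :: "real ^ 'i ^ 'i \<Rightarrow> 'i::finite list \<Rightarrow> real ^ 'i \<Rightarrow> real ^ 'i" where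
  "word_action C w \<beta> = foldr (simple_reflection C) w \<beta>"

definition W_orbit :: "real ^ 'i ^ 'i \<Rightarrow> real ^ 'i::finite \<Rightarrow> (real ^ 'i) set" where
  "W_orbit C \<beta> = range (\<lambda>w. word_action C w \<beta>)"

definition roots :: "real ^ 'i ^ 'i \<Rightarrow> (real ^ 'i::finite) set" where
  "roots C = (\<Union>i. W_orbit C (simple_root i))"

definition pos_roots :: "real ^ 'i ^ 'i \<Rightarrow> (real ^ 'i::finite) set" where
  "pos_roots C = {\<beta> \<in> roots C. \<forall>i. 0 \<le> \<beta> $ i}"

definition neg_roots :: "real ^ 'i ^ 'i \<Rightarrow> (real ^ 'i::finite) set" where
  "neg_roots C = uminus ` pos_roots C"

definition root_step :: "real ^ 'i ^ 'i \<Rightarrow> real ^ 'i \<Rightarrow> real ^ 'i::finite \<Rightarrow> bool" where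
  "root_step C \<beta> \<gamma> \<longleftrightarrow> \<beta> \<in> pos_roots C \<and> \<gamma> \<in> pos_roots C \<and>
     (\<exists>i. \<gamma> = simple_reflection C i \<beta> \<and> \<beta> $ i < \<gamma> $ i)"

definition root_less :: "real ^ 'i ^ 'i \<Rightarrow> real ^ 'i \<Rightarrow> real ^ 'i::finite \<Rightarrow> bool" where
  "root_less C = (root_step C)\<^sup>+\<^sup>+"

definition root_le :: "real ^ 'i ^ 'i \<Rightarrow> real ^ 'i \<Rightarrow> real ^ 'i::finite \<Rightarrow> bool" where
  "root_le C \<alpha> \<beta> \<longleftrightarrow> root_less C \<alpha> \<beta> \<or> \<alpha> = \<beta>"

definition depth :: "real ^ 'i ^ 'i \<Rightarrow> real ^ 'i::finite \<Rightarrow> nat" where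
  "depth C \<beta> = (LEAST k. \<exists>w. length w = k \<and> word_action C w \<beta> \<in> neg_roots C)"

text \<open>
  The number \<open>m'(v)\<close>, meaningful only if some such \<open>\<beta>\<close> exists.  A positive root is not
  negative, so its depth is at least 1 and the subtraction does not truncate.
\<close>

definition min_depth :: "real ^ 'i ^ 'i \<Rightarrow> real ^ 'i::finite \<Rightarrow> nat" where
  "min_depth C v = (LEAST m. m \<in> {depth C \<beta> - 1 | \<beta>.
     \<beta> \<in> pos_roots C \<and> \<beta> \<bullet> v < -1 \<and> (\<exists>i. root_le C (simple_root i) \<beta>)})"

end

theory Submission imports Defs begin

text \<open>
  Firing is adjoint to reflecting: \<open>\<beta> \<bullet> f\<^sub>i v = s\<^sub>i \<beta> \<bullet> v\<close>.  Hence a game reaching a forbidden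
  configuration is traced backwards by roots climbing from a simple root, a step that would lower
  the root being skipped because \<open>v\<^sub>i < 0\<close>; conversely, descending a chain from \<open>\<beta>\<close> to a simple
  root gives a game, in which a descent at \<open>i\<close> with \<open>v\<^sub>i \<ge> 0\<close> needs no move.  It remains to see that
  the length of a chain above a simple root is the depth minus one.  This is the argument of Brink
  and Howlett, which needs that \<open>w \<alpha>\<^sub>i \<ge> 0\<close> unless \<open>w s\<^sub>i\<close> is shorter than \<open>w\<close>; the latter is
  reduced to rank two by factoring off a maximal dihedral suffix of a reduced word.
\<close>

section \<open>Chebyshev recurrences and alternating words\<close>

text \<open>\<open>cheb g k\<close> is the Chebyshev polynomial of the second kind of degree k - 1
  at g/2, i.e. sin(k \<theta>)/sin \<theta> for g = 2 cos \<theta> with sin \<theta> nonzero. These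
  numbers become the coefficients of roots in rank two.\<close>

fun cheb :: "real \<Rightarrow> nat \<Rightarrow> real" where
  "cheb g 0 = 0"
| "cheb g (Suc 0) = 1"
| "cheb g (Suc (Suc k)) = g * cheb g (Suc k) - cheb g k"

lemma cheb_cos: "cheb (2 * cos \<theta>) k * sin \<theta> = sin (real k * \<theta>)"
proof (induction k rule: induct_nat_012)
  case (ge2 k)
  have "sin (real (Suc (Suc k)) * \<theta>) = 2 * cos \<theta> * sin (real (Suc k) * \<theta>) - sin (real k * \<theta>)"
  proof -
    have "sin (real (Suc (Suc k)) * \<theta>) = sin (real (Suc k) * \<theta> + \<theta>)"
      "sin (real k * \<theta>) = sin (real (Suc k) * \<theta> - \<theta>)"
      by (simp_all add: algebra_simps)
    then show ?thesis by (simp only: sin_add sin_diff) simp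
  qed
  with ge2 show ?case by (simp add: algebra_simps)
qed auto

lemma sin_pi_div_pos: "2 \<le> m \<Longrightarrow> 0 < sin (pi / real m)"
  by (rule sin_gt_zero) (auto simp: field_simps)

lemma cheb_cos_nonneg:
  assumes "2 \<le> m" "k \<le> m"
  shows "0 \<le> cheb (2 * cos (pi / real m)) k"
proof -
  have "0 \<le> sin (real k * (pi / real m))"
    using assms by (intro sin_ge_zero) (auto simp: field_simps)
  then show ?thesis
    using cheb_cos[of "pi / real m" k] sin_pi_div_pos[OF assms(1)]
    by (metis mult_less_0_iff not_le)
qed

lemma cheb_cos_zero:
  assumes "2 \<le> m"
  shows "cheb (2 * cos (pi / real m)) m = 0"
  using cheb_cos[of "pi / real m" m] sin_pi_div_pos[OF assms] assms by auto

text \<open>For g \<ge> 2 the increments do not shrink while the values are nonnegative, so sign and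
  monotonicity are carried through one induction.\<close>

lemma cheb_ge_2:
  assumes "2 \<le> g"
  shows "0 \<le> cheb g k \<and> cheb g k \<le> cheb g (Suc k)"
proof (induction k)
  case (Suc k)
  have "2 * cheb g (Suc k) \<le> g * cheb g (Suc k)"
    using Suc assms by (intro mult_right_mono) auto
  with Suc show ?case by auto
qed simp

text \<open>The alternating word of length k whose last letter, the first one to act, is t.
  Recursion at the right end makes peeling off a letter swap s and t.\<close>

fun alt :: "nat \<Rightarrow> 'a \<Rightarrow> 'a \<Rightarrow> 'a list" where
  "alt 0 s t = []"
| "alt (Suc k) s t = alt k t s @ [t]"

lemma length_alt [simp]: "length (alt k s t) = k"
  by (induction k arbitrary: s t) auto

lemma alt_suffix: "m \<le> k \<Longrightarrow> \<exists>c. alt k s t = c @ alt m s t"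
proof (induction k arbitrary: s t m)
  case (Suc k)
  show ?case
  proof (cases m)
    case (Suc m')
    with Suc.IH[of m' t s] Suc.prems show ?thesis by auto
  qed auto
qed auto

section \<open>Reflections and words\<close>

context weighted_coxeter_graph
begin

abbreviation refl :: "'i \<Rightarrow> real ^ 'i \<Rightarrow> real ^ 'i" where
  "refl \<equiv> simple_reflection C"

abbreviation wa :: "'i list \<Rightarrow> real ^ 'i \<Rightarrow> real ^ 'i" where
  "wa \<equiv> word_action C"

abbreviation sr :: "'i \<Rightarrow> real ^ 'i" where
  "sr \<equiv> simple_root"

abbreviation pairing :: "'i \<Rightarrow> real ^ 'i \<Rightarrow> real" where
  "pairing i \<beta> \<equiv> (C *v \<beta>) $ i"

lemma sr_nth: "sr i $ j = (if i = j then 1 else 0)"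
  by (simp add: simple_root_def axis_def)

lemma pairing_sr: "pairing i (sr j) = C $ i $ j"
  by (simp add: matrix_vector_mult_def sr_nth if_distrib cong: if_cong)

lemma refl_eq: "refl i \<beta> = \<beta> - pairing i \<beta> *\<^sub>R sr i"
proof -
  have "pairing i \<beta> = 2 * \<beta> $ i + (\<Sum>k\<in>UNIV - {i}. C $ i $ k * \<beta> $ k)"
    by (simp add: matrix_vector_mult_def sum.remove[of UNIV i] C_diag)
  then show ?thesis
    by (simp add: vec_eq_iff simple_reflection_def sr_nth)
qed

lemma refl_nth: "refl i \<beta> $ j = \<beta> $ j - (if i = j then pairing i \<beta> else 0)"
  by (simp add: refl_eq sr_nth)

lemma linear_refl: "linear (refl i)"
  by (rule linearI) (simp_all add: refl_eq matrix_vector_right_distrib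
      matrix_vector_mult_scaleR algebra_simps)

lemma refl_sr: "refl i (sr i) = - sr i"
  by (simp add: refl_eq pairing_sr C_diag scaleR_2)

lemma refl_refl [simp]: "refl i (refl i \<beta>) = \<beta>"
  by (simp add: refl_eq matrix_vector_mult_diff_distrib matrix_vector_mult_scaleR pairing_sr
      C_diag algebra_simps)

lemma wa_simps [simp]:
  "wa [] \<beta> = \<beta>" "wa (i # w) \<beta> = refl i (wa w \<beta>)" "wa (a @ b) \<beta> = wa a (wa b \<beta>)"
  by (simp_all add: word_action_def)

lemma linear_wa: "linear (wa w)"
  by (induction w) (auto intro!: linearI simp: linear_add linear_scale linear_refl)

lemmas wa_add = linear_add[OF linear_wa]
  and wa_diff = linear_diff[OF linear_wa]
  and wa_scale = linear_scale[OF linear_wa]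
  and wa_minus = linear_neg[OF linear_wa]

lemma wa_rev [simp]: "wa (rev w) (wa w \<beta>) = \<beta>"
  by (induction w arbitrary: \<beta>) auto

lemma wa_inj: "wa w \<beta> = wa w \<gamma> \<Longrightarrow> \<beta> = \<gamma>"
  by (metis wa_rev)

section \<open>Rank two\<close>

text \<open>C need not be symmetric, but replacing \<alpha>_t by r \<alpha>_t makes both
  off-diagonal entries equal to -g. All sign questions in rank two then depend on g alone.\<close>

lemma rank_two_parameters:
  assumes "s \<noteq> t"
  obtains g r where "r > 0" "C $ t $ s = - (g * r)" "C $ s $ t = - (g / r)"
    "\<And>m. n s t = enat m \<Longrightarrow> 2 \<le> m \<and> g = 2 * cos (pi / real m)"
    "n s t = \<infinity> \<Longrightarrow> 2 \<le> g"
proof (cases "adj s t")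
  case True
  then have "adj t s" using adj_iff n_sym by metis
  define a where "a = - C $ s $ t"
  define b where "b = - C $ t $ s"
  have ab: "a > 0" "b > 0" using C_neg[OF True] C_neg[OF \<open>adj t s\<close>] by (auto simp: a_def b_def)
  define g where "g = sqrt (a * b)"
  define r where "r = sqrt (b / a)"
  have gab: "g\<^sup>2 = C $ s $ t * C $ t $ s" "g > 0"
    using ab mult_pos_pos[OF ab] by (simp_all add: g_def a_def b_def)
  have 1: "r > 0" using ab by (simp add: r_def)
  have 2: "C $ t $ s = - (g * r)"
  proof -
    have "g * r = sqrt (b\<^sup>2)" unfolding g_def r_def real_sqrt_mult[symmetric]
      using ab by (simp add: power2_eq_square)
    with ab show ?thesis by (simp add: b_def)
  qed
  have 3: "C $ s $ t = - (g / r)"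
  proof -
    have "g / r = sqrt (a\<^sup>2)" unfolding g_def r_def real_sqrt_divide[symmetric]
      using ab by (simp add: power2_eq_square)
    with ab show ?thesis by (simp add: a_def)
  qed
  have 4: "2 \<le> m \<and> g = 2 * cos (pi / real m)" if m: "n s t = enat m" for m
  proof -
    have "enat 3 \<le> enat m" using True adj_iff[of s t] m by (simp add: numeral_eq_enat)
    then have m3: "3 \<le> m" by simp
    \<comment> \<open>The matrix entries determine only g^2; a nonnegative cosine fixes the sign of
      the root.\<close>
    have "pi / real m \<le> pi / 2" using m3 by (intro frac_le) auto
    moreover have "- (pi / 2) \<le> pi / real m" by (rule order_trans[of _ 0]) auto
    ultimately have "0 \<le> cos (pi / real m)" by (intro cos_ge_zero)
    have "g = 2 * cos (pi / real m)"
    proof (rule power2_eq_imp_eq)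
      show "g\<^sup>2 = (2 * cos (pi / real m))\<^sup>2"
        using gab(1) C_finite[OF True m] by (simp add: power_mult_distrib)
    qed (use gab(2) \<open>0 \<le> cos (pi / real m)\<close> in auto)
    with m3 show ?thesis by auto
  qed
  have 5: "2 \<le> g" if "n s t = \<infinity>"
  proof (rule power2_le_imp_le)
    show "2\<^sup>2 \<le> g\<^sup>2" using C_infinite[OF True that] gab by simp
  qed (use gab in simp)
  show ?thesis by (rule that[OF 1 2 3 4 5])
next
  case False
  then have "\<not> adj t s" using adj_iff n_sym by metis
  have "\<not> enat 3 \<le> n s t" using False adj_iff assms by (simp add: numeral_eq_enat)
  moreover have "enat 2 \<le> n s t" using n_ge_2[OF assms] by (simp add: numeral_eq_enat)
  ultimately have 2: "n s t = enat 2" by (cases "n s t") auto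
  show ?thesis
    \<comment> \<open>The commuting case fits the same pattern: m = 2 and g = 0 = 2
      cos(pi/2).\<close>
    by (rule that[of 1 0]) (use 2 False \<open>\<not> adj t s\<close> assms C_nonadj in auto)
qed

text \<open>In the basis \<open>sr s\<close>, \<open>r *\<^sub>R sr t\<close> the coefficients are
  consecutive Chebyshev numbers. Removing the last letter exchanges s and t and turns r into 1/r,
  hence the generalization over r.\<close>

lemma wa_alt_sr:
  assumes "r > 0" "C $ t $ s = - (g * r)" "C $ s $ t = - (g / r)"
  shows "wa (alt k s t) (sr s) =
    (if even k then cheb g (Suc k) *\<^sub>R sr s + (r * cheb g k) *\<^sub>R sr t
     else cheb g k *\<^sub>R sr s + (r * cheb g (Suc k)) *\<^sub>R sr t)"
  using assms
proof (induction k arbitrary: s t r rule: induct_nat_012)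
  case 0
  then show ?case by simp
next
  case 1
  then show ?case by (simp add: refl_eq pairing_sr mult.commute)
next
  case (ge2 k)
  have IH: "wa (alt (Suc k) t s) (sr t) =
    (if even (Suc k) then cheb g (Suc (Suc k)) *\<^sub>R sr t + (1 / r * cheb g (Suc k)) *\<^sub>R sr s
     else cheb g (Suc k) *\<^sub>R sr t + (1 / r * cheb g (Suc (Suc k))) *\<^sub>R sr s)"
    using ge2.prems by (intro ge2.IH) auto
  have "wa (alt (Suc (Suc k)) s t) (sr s) = wa (alt (Suc k) t s) (sr s + (g * r) *\<^sub>R sr t)"
    using ge2.prems by (simp add: refl_eq pairing_sr)
  also have "\<dots> = wa (alt (Suc k) t s) (sr s) + (g * r) *\<^sub>R wa (alt (Suc k) t s) (sr t)"
    by (simp only: wa_add wa_scale)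
  \<comment> \<open>This word ends in s, which negates \<open>sr s\<close>; the sign supplies the
    subtracted term of the Chebyshev recurrence.\<close>
  also have "wa (alt (Suc k) t s) (sr s) = - wa (alt k s t) (sr s)"
    by (simp add: refl_sr wa_minus)
  finally have eq: "wa (alt (Suc (Suc k)) s t) (sr s) =
    - wa (alt k s t) (sr s) + (g * r) *\<^sub>R wa (alt (Suc k) t s) (sr t)" .
  show ?case
    unfolding eq IH ge2.IH(1)[OF ge2.prems] using ge2.prems(1)
    by (auto simp: algebra_simps)
qed

text \<open>The factor \<open>cheb g k\<close> reduces the braid relation on the whole space to the
  vanishing of one number, without splitting off the plane spanned by the two roots.\<close>

lemma wa_alt_diff:
  assumes "r > 0" "C $ t $ s = - (g * r)" "C $ s $ t = - (g / r)"
  shows "wa (alt k s t) \<beta> - wa (alt k t s) \<beta> = cheb g k *\<^sub>R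
    (if even k then (pairing s \<beta> * r) *\<^sub>R sr t - (pairing t \<beta> / r) *\<^sub>R sr s
     else pairing s \<beta> *\<^sub>R sr s - pairing t \<beta> *\<^sub>R sr t)"
proof (induction k)
  case (Suc k)
  have E: "wa (alt k s t) (sr s) =
    (if even k then cheb g (Suc k) *\<^sub>R sr s + (r * cheb g k) *\<^sub>R sr t
     else cheb g k *\<^sub>R sr s + (r * cheb g (Suc k)) *\<^sub>R sr t)"
    by (rule wa_alt_sr[OF assms])
  have F: "wa (alt k t s) (sr t) =
    (if even k then cheb g (Suc k) *\<^sub>R sr t + (1 / r * cheb g k) *\<^sub>R sr s
     else cheb g k *\<^sub>R sr t + (1 / r * cheb g (Suc k)) *\<^sub>R sr s)"
    by (rule wa_alt_sr) (use assms in auto)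
  have "wa (alt (Suc k) s t) \<beta> - wa (alt (Suc k) t s) \<beta> =
      - (wa (alt k s t) \<beta> - wa (alt k t s) \<beta>)
      + pairing s \<beta> *\<^sub>R wa (alt k s t) (sr s) - pairing t \<beta> *\<^sub>R wa (alt k t s) (sr t)"
    by (simp add: refl_eq wa_diff wa_scale)
  then show ?case
    unfolding Suc.IH E F by (auto simp: algebra_simps)
qed simp

lemma braid:
  assumes "s \<noteq> t" "n s t = enat m"
  shows "wa (alt m s t) = wa (alt m t s)"
proof
  fix \<beta>
  obtain g r where gr: "r > 0" "C $ t $ s = - (g * r)" "C $ s $ t = - (g / r)"
    and m: "\<And>m. n s t = enat m \<Longrightarrow> 2 \<le> m \<and> g = 2 * cos (pi / real m)"
    using rank_two_parameters[OF assms(1)] by metis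
  have "cheb g m = 0" using m[OF assms(2)] cheb_cos_zero by auto
  with wa_alt_diff[OF gr, of m \<beta>] show "wa (alt m s t) \<beta> = wa (alt m t s) \<beta>" by simp
qed

section \<open>Reduced words and positivity of roots\<close>

text \<open>Length is taken in the group of linear maps generated by the reflections: words are
  identified when they act equally, so faithfulness of the representation is not at issue.\<close>

definition reduced :: "'i list \<Rightarrow> bool" where
  "reduced w \<longleftrightarrow> (\<forall>w'. wa w' = wa w \<longrightarrow> length w \<le> length w')"

text \<open>s is not a right descent of the reduced word w. The weak inequality avoids a parity
  argument on lengths.\<close>

definition no_descent :: "'i list \<Rightarrow> 'i \<Rightarrow> bool" where
  "no_descent w s \<longleftrightarrow> reduced w \<and> (\<forall>w'. wa w' = wa (w @ [s]) \<longrightarrow> length w \<le> length w')"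

lemma exists_reduced: "\<exists>w'. reduced w' \<and> wa w' = wa w"
proof -
  obtain w' where "wa w' = wa w" "\<And>u. wa u = wa w \<Longrightarrow> length w' \<le> length u"
    using ex_has_least_nat[of "\<lambda>u. wa u = wa w" w length] by auto
  then show ?thesis unfolding reduced_def by metis
qed

lemma reduced_prefix:
  assumes "reduced (a @ b)"
  shows "reduced a"
  unfolding reduced_def
proof (intro allI impI)
  fix w' assume "wa w' = wa a"
  then have "wa (w' @ b) = wa (a @ b)" by (auto simp: fun_eq_iff)
  with assms show "length a \<le> length w'" unfolding reduced_def by fastforce
qed

lemma reduced_suffix:
  assumes "reduced (a @ b)"
  shows "reduced b"
  unfolding reduced_def
proof (intro allI impI)
  fix w' assume "wa w' = wa b"
  then have "wa (a @ w') = wa (a @ b)" by (auto simp: fun_eq_iff)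
  with assms show "length b \<le> length w'" unfolding reduced_def by fastforce
qed

lemma no_descent_last:
  assumes "no_descent (w @ [t]) s"
  shows "t \<noteq> s"
proof
  assume "t = s"
  then have "wa w = wa ((w @ [t]) @ [s])" by (auto simp: fun_eq_iff)
  with assms show False unfolding no_descent_def by fastforce
qed

lemma no_descent_butlast:
  assumes "reduced (w @ [t])"
  shows "no_descent w t"
  unfolding no_descent_def
proof (intro conjI allI impI)
  show "reduced w" using assms by (rule reduced_prefix)
  fix w' assume "wa w' = wa (w @ [t])"
  with assms show "length w \<le> length w'" unfolding reduced_def by fastforce
qed

text \<open>The last letter cannot be s, so it is t; by reducedness the remaining word has no
  descent at t, and the roles swap.\<close>

lemma no_descent_eq_alt:
  "no_descent b s \<Longrightarrow> set b \<subseteq> {s, t} \<Longrightarrow> b = alt (length b) s t"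
proof (induction b arbitrary: s t rule: rev_induct)
  case (snoc x b)
  have "x = t" using no_descent_last[OF snoc.prems(1)] snoc.prems(2) by auto
  have "no_descent b t"
    using snoc.prems(1) \<open>x = t\<close> unfolding no_descent_def[of "b @ [x]"]
    by (auto intro: no_descent_butlast)
  then have "b = alt (length b) t s" using snoc.prems(2) by (intro snoc.IH) auto
  with \<open>x = t\<close> show ?case by simp
qed simp

lemma no_descent_alt_less:
  assumes "no_descent (alt k s t) s" "s \<noteq> t" "n s t = enat m"
  shows "k < m"
proof (rule ccontr)
  assume "\<not> k < m"
  then obtain c where c: "alt k s t = c @ alt m s t" using alt_suffix[of m k s t] by auto
  have m: "m \<noteq> 0" using n_ge_2[OF assms(2)] assms(3) by (auto simp: numeral_eq_enat)
  then obtain m' where m': "m = Suc m'" by (cases m) auto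
  \<comment> \<open>A braid move on the suffix of length m makes the word end in s, which cancels
    against the appended s and yields a word that is too short.\<close>
  have "wa (alt k s t @ [s]) = wa (c @ alt m t s @ [s])"
    using braid[OF assms(2,3)] by (simp add: c fun_eq_iff)
  also have "\<dots> = wa (c @ alt m' s t)" by (simp add: m' fun_eq_iff)
  finally have "length (alt k s t) \<le> length (c @ alt m' s t)"
    using assms(1) unfolding no_descent_def by metis
  moreover have "length (alt k s t) = length (c @ alt m s t)" using c by simp
  ultimately show False using m' by simp
qed

lemma dihedral_positive:
  assumes "no_descent b s" "set b \<subseteq> {s, t}" "s \<noteq> t"
  shows "\<exists>x y. 0 \<le> x \<and> 0 \<le> y \<and> wa b (sr s) = x *\<^sub>R sr s + y *\<^sub>R sr t"
proof -
  obtain g r where gr: "r > 0" "C $ t $ s = - (g * r)" "C $ s $ t = - (g / r)"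
    and m: "\<And>m. n s t = enat m \<Longrightarrow> 2 \<le> m \<and> g = 2 * cos (pi / real m)"
    and inf: "n s t = \<infinity> \<Longrightarrow> 2 \<le> g"
    using rank_two_parameters[OF assms(3)] by metis
  define k where "k = length b"
  have b: "b = alt k s t" using no_descent_eq_alt[OF assms(1,2)] by (simp add: k_def)
  have "0 \<le> cheb g k \<and> 0 \<le> cheb g (Suc k)"
  proof (cases "n s t")
    case (enat m')
    \<comment> \<open>The strict bound matters: the coefficients involve the index k + 1, and
      nonnegativity is known only up to m'.\<close>
    have "k < m'" using no_descent_alt_less[OF _ assms(3) enat] assms(1) b by metis
    with m[OF enat] show ?thesis using cheb_cos_nonneg by simp
  next
    case infinity
    with cheb_ge_2[OF inf] show ?thesis by metis
  qed
  with gr(1) have "0 \<le> cheb g k" "0 \<le> cheb g (Suc k)" "0 \<le> r * cheb g k" "0 \<le> r * cheb g (Suc k)"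
    by simp_all
  then have "0 \<le> (if even k then cheb g (Suc k) else cheb g k)"
    "0 \<le> (if even k then r * cheb g k else r * cheb g (Suc k))"
    by simp_all
  moreover have "wa b (sr s) =
    (if even k then cheb g (Suc k) else cheb g k) *\<^sub>R sr s
    + (if even k then r * cheb g k else r * cheb g (Suc k)) *\<^sub>R sr t"
    unfolding b wa_alt_sr[OF gr] by simp
  ultimately show ?thesis by (intro exI conjI)
qed

text \<open>Factor w as a b with b in the letters s, t and a as short as possible. Then b sends
  \<alpha>_s to a nonnegative combination of \<alpha>_s and \<alpha>_t, and the shorter a keeps both
  nonnegative by induction.\<close>

lemma no_descent_positive:
  "no_descent w s \<Longrightarrow> 0 \<le> wa w (sr s) $ j"
proof (induction "length w" arbitrary: w s rule: less_induct)
  case less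
  show ?case
  proof (cases w rule: rev_cases)
    case Nil
    then show ?thesis by (simp add: sr_nth)
  next
    case (snoc w0 t)
    have st: "s \<noteq> t" using no_descent_last less.prems snoc by blast
    \<comment> \<open>The factorization concerns the action of w, not its spelling, but the lengths
      must add up; so \<open>a @ b\<close> is again reduced.\<close>
    define fact where "fact a b \<longleftrightarrow> wa (a @ b) = wa w \<and> length a + length b = length w
      \<and> set b \<subseteq> {s, t}" for a b
    have "\<exists>b. fact w0 b" unfolding fact_def snoc by (intro exI[of _ "[t]"]) auto
    then obtain a where "\<exists>b. fact a b"
      and amin: "\<And>a'. \<exists>b. fact a' b \<Longrightarrow> length a \<le> length a'"
      using ex_has_least_nat[of "\<lambda>a. \<exists>b. fact a b" w0 length] by metis
    then obtain b where b: "fact a b" by blast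
    have red: "reduced w" using less.prems by (simp add: no_descent_def)
    then have redab: "reduced (a @ b)" using b unfolding reduced_def fact_def by simp
    have "length a \<le> length w0" by (rule amin) fact
    then have "length a < length w" by (simp add: snoc)
    have nd: "no_descent a x" if "x \<in> {s, t}" for x
      unfolding no_descent_def
    proof (intro conjI allI impI)
      show "reduced a" using redab by (rule reduced_prefix)
      fix w' assume w': "wa w' = wa (a @ [x])"
      show "length a \<le> length w'"
      proof (rule ccontr)
        assume less': "\<not> length a \<le> length w'"
        \<comment> \<open>If appending x shortened a, then moving x over to b would give a
          factorization with a shorter left part.\<close>
        have "wa (w' @ x # b) = wa w" using w' b by (auto simp: fun_eq_iff fact_def)
        moreover from this have "length w \<le> length (w' @ x # b)"
          using red unfolding reduced_def by blast
        ultimately have "fact w' (x # b)" using less' b that by (auto simp: fact_def)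
        then show False using amin[of w'] less' by blast
      qed
    qed
    have ndb: "no_descent b s"
      unfolding no_descent_def
    proof (intro conjI allI impI)
      show "reduced b" using redab by (rule reduced_suffix)
      fix w' assume "wa w' = wa (b @ [s])"
      then have "wa (a @ w') = wa (w @ [s])" using b by (auto simp: fun_eq_iff fact_def)
      then have "length w \<le> length (a @ w')" using less.prems unfolding no_descent_def by blast
      then show "length b \<le> length w'" using b by (simp add: fact_def)
    qed
    have "set b \<subseteq> {s, t}" using b by (simp add: fact_def)
    from dihedral_positive[OF ndb this st] obtain x y where xy: "0 \<le> x" "0 \<le> y"
      "wa b (sr s) = x *\<^sub>R sr s + y *\<^sub>R sr t" by blast
    have "wa w (sr s) = wa a (wa b (sr s))"
      using b unfolding fact_def by (metis wa_simps(3))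
    also have "\<dots> = x *\<^sub>R wa a (sr s) + y *\<^sub>R wa a (sr t)"
      by (simp only: xy wa_add wa_scale)
    finally show ?thesis
      using xy less.hyps[OF \<open>length a < length w\<close> nd] by simp
  qed
qed

text \<open>A reduced word for w s has no descent at s, since appending s returns to w, which is
  longer. Passing to it costs only a sign on \<alpha>_s.\<close>

lemma not_no_descent:
  assumes "reduced w" "\<not> no_descent w s"
  obtains w' where "wa w' = wa (w @ [s])" "length w' < length w" "no_descent w' s"
proof -
  obtain u where u: "wa u = wa (w @ [s])" "length u < length w"
    using assms by (auto simp: no_descent_def not_le)
  obtain w' where w': "reduced w'" "wa w' = wa u" using exists_reduced by blast
  then have "length w' \<le> length u" unfolding reduced_def by auto
  have "wa (w' @ [s]) = wa w" using w' u by (auto simp: fun_eq_iff)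
  then have "no_descent w' s"
    unfolding no_descent_def
  proof (intro conjI allI impI)
    fix x assume "wa x = wa (w' @ [s])"
    then have "length w \<le> length x"
      using \<open>wa (w' @ [s]) = wa w\<close> assms(1) by (simp add: reduced_def)
    then show "length w' \<le> length x" using \<open>length w' \<le> length u\<close> u(2) by simp
  qed (use w' in simp)
  with that[of w'] w' u \<open>length w' \<le> length u\<close> show ?thesis by simp
qed

section \<open>Roots: closure properties and the positive/negative dichotomy\<close>

lemma rootsE:
  assumes "\<beta> \<in> roots C"
  obtains w s where "\<beta> = wa w (sr s)"
  using assms by (auto simp: roots_def W_orbit_def)

lemma rootsI: "wa w (sr s) \<in> roots C"
  by (auto simp: roots_def W_orbit_def)

lemma roots_wa:
  assumes "\<beta> \<in> roots C"
  shows "wa w \<beta> \<in> roots C"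
proof -
  obtain u s where "\<beta> = wa u (sr s)" using assms by (rule rootsE)
  then show ?thesis using rootsI[of "w @ u" s] by simp
qed

lemma roots_uminus:
  assumes "\<beta> \<in> roots C"
  shows "- \<beta> \<in> roots C"
proof -
  obtain w s where "\<beta> = wa w (sr s)" using assms by (rule rootsE)
  then have "- \<beta> = wa (w @ [s]) (sr s)" by (simp add: refl_sr wa_minus)
  then show ?thesis by (simp only: rootsI)
qed

lemma root_nonzero:
  assumes "\<beta> \<in> roots C"
  shows "\<beta> \<noteq> 0"
proof
  assume "\<beta> = 0"
  obtain w s where "\<beta> = wa w (sr s)" using assms by (rule rootsE)
  with \<open>\<beta> = 0\<close> have "wa w (sr s) = wa w 0" by (simp add: linear_0[OF linear_wa])
  then have "sr s = 0" by (rule wa_inj)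
  then show False using sr_nth[of s s] by simp
qed

lemma neg_roots_iff: "\<beta> \<in> neg_roots C \<longleftrightarrow> \<beta> \<in> roots C \<and> (\<forall>i. \<beta> $ i \<le> 0)"
proof
  assume "\<beta> \<in> neg_roots C"
  then show "\<beta> \<in> roots C \<and> (\<forall>i. \<beta> $ i \<le> 0)"
    by (auto simp: neg_roots_def pos_roots_def roots_uminus)
next
  assume "\<beta> \<in> roots C \<and> (\<forall>i. \<beta> $ i \<le> 0)"
  then have "- \<beta> \<in> pos_roots C" by (auto simp: pos_roots_def roots_uminus)
  then show "\<beta> \<in> neg_roots C" unfolding neg_roots_def by force
qed

lemma root_pos_or_neg:
  assumes "\<beta> \<in> roots C"
  shows "\<beta> \<in> pos_roots C \<or> \<beta> \<in> neg_roots C"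
proof -
  obtain u s where u: "\<beta> = wa u (sr s)" using assms by (rule rootsE)
  obtain w where w: "reduced w" "wa w = wa u" using exists_reduced by blast
  show ?thesis
  proof (cases "no_descent w s")
    case True
    then show ?thesis using no_descent_positive[OF True] w u assms by (auto simp: pos_roots_def)
  next
    case False
    then obtain w' where w': "wa w' = wa (w @ [s])" "no_descent w' s"
      using not_no_descent[OF w(1)] by metis
    have "\<beta> = - wa w' (sr s)" using w' w u by (simp add: refl_sr wa_minus)
    then show ?thesis
      using no_descent_positive[OF w'(2)] assms by (auto simp: neg_roots_iff)
  qed
qed

lemma pos_roots_not_neg:
  assumes "\<beta> \<in> pos_roots C"
  shows "\<beta> \<notin> neg_roots C"
proof
  assume "\<beta> \<in> neg_roots C"
  with assms have "\<beta> = 0"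
    by (auto simp: neg_roots_iff pos_roots_def vec_eq_iff intro: antisym)
  with assms root_nonzero show False by (auto simp: pos_roots_def)
qed

lemma sr_pos_roots: "sr i \<in> pos_roots C"
  using rootsI[of "[]" i] by (auto simp: pos_roots_def sr_nth)

section \<open>Depth\<close>

lemma depth_le: "wa w \<beta> \<in> neg_roots C \<Longrightarrow> depth C \<beta> \<le> length w"
  unfolding depth_def by (rule Least_le) auto

lemma depth_attained:
  assumes "\<beta> \<in> roots C"
  obtains w where "length w = depth C \<beta>" "wa w \<beta> \<in> neg_roots C"
proof -
  obtain u s where "\<beta> = wa u (sr s)" using assms by (rule rootsE)
  \<comment> \<open>Undoing u and then applying s gives a negative root, so the least number
    defining the depth exists.\<close>
  then have "wa (s # rev u) \<beta> = - sr s" by (simp add: refl_sr)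
  then have "wa (s # rev u) \<beta> \<in> neg_roots C" using sr_pos_roots by (simp add: neg_roots_def)
  then have "\<exists>w. length w = length (s # rev u) \<and> wa w \<beta> \<in> neg_roots C" by blast
  from LeastI[of "\<lambda>k. \<exists>w. length w = k \<and> wa w \<beta> \<in> neg_roots C", OF this] that
  show ?thesis unfolding depth_def by blast
qed

lemma depth_sr: "depth C (sr i) = 1"
proof -
  have "wa [i] (sr i) \<in> neg_roots C"
    using sr_pos_roots by (simp add: neg_roots_def refl_sr)
  then have "depth C (sr i) \<le> 1" using depth_le by fastforce
  moreover have "depth C (sr i) \<noteq> 0"
  proof
    assume "depth C (sr i) = 0"
    moreover have "sr i \<in> roots C" using sr_pos_roots by (simp add: pos_roots_def)
    ultimately obtain w where "length w = 0" "wa w (sr i) \<in> neg_roots C"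
      using depth_attained by metis
    then show False using pos_roots_not_neg[OF sr_pos_roots] by simp
  qed
  ultimately show ?thesis by simp
qed

text \<open>The reflection changes only coordinate x, so every other coordinate is both nonnegative
  and nonpositive. The factor d may differ from 1: for nonsymmetric C an orbit can contain a proper
  multiple of a simple root.\<close>

lemma pos_to_neg:
  assumes "\<beta> \<in> pos_roots C" "refl x \<beta> \<in> neg_roots C"
  obtains d where "d > 0" "\<beta> = d *\<^sub>R sr x"
proof -
  have "\<beta> $ j = 0" if "j \<noteq> x" for j
  proof (rule antisym)
    show "0 \<le> \<beta> $ j" using assms(1) by (simp add: pos_roots_def)
    have "refl x \<beta> $ j \<le> 0" using assms(2) by (simp add: neg_roots_iff)
    then show "\<beta> $ j \<le> 0" using that by (simp add: refl_nth)
  qed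
  then have eq: "\<beta> = (\<beta> $ x) *\<^sub>R sr x" by (auto simp: vec_eq_iff sr_nth)
  have "\<beta> $ x \<noteq> 0"
  proof
    assume "\<beta> $ x = 0"
    with eq have "\<beta> = 0" by (simp only: scale_zero_left)
    with assms(1) root_nonzero show False by (auto simp: pos_roots_def)
  qed
  then have "\<beta> $ x > 0" using assms(1) by (simp add: pos_roots_def order_less_le)
  then show ?thesis using eq by (rule that)
qed

lemma depth_refl_le:
  assumes "\<beta> \<in> roots C"
  shows "depth C (refl i \<beta>) \<le> Suc (depth C \<beta>)"
proof -
  obtain w where w: "length w = depth C \<beta>" "wa w \<beta> \<in> neg_roots C"
    using depth_attained[OF assms] .
  then have "wa (w @ [i]) (refl i \<beta>) \<in> neg_roots C" by simp
  from depth_le[OF this] w show ?thesis by simp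
qed

text \<open>Take a shortest w making \<gamma> = \<alpha> + c \<alpha>_i negative. If i is a descent
  of w, then w s_i is shorter and works for \<alpha>. Otherwise w \<alpha>_i \<ge> 0, so w makes
  \<alpha> negative too, and it remains to save one letter.\<close>

lemma depth_less_refl:
  assumes "\<alpha> \<in> pos_roots C" "pairing i \<alpha> < 0"
  shows "depth C \<alpha> < depth C (refl i \<alpha>)"
proof -
  define \<gamma> where "\<gamma> = refl i \<alpha>"
  define c where "c = - pairing i \<alpha>"
  have c: "c > 0" and \<gamma>: "\<gamma> = \<alpha> + c *\<^sub>R sr i"
    using assms by (simp_all add: c_def \<gamma>_def refl_eq)
  have r: "\<alpha> \<in> roots C" "\<gamma> \<in> roots C"
    using assms(1) roots_wa[of \<alpha> "[i]"] by (auto simp: pos_roots_def \<gamma>_def)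
  have pos: "\<gamma> \<in> pos_roots C"
    using assms(1) r c by (auto simp: pos_roots_def \<gamma> sr_nth)
  obtain w where w: "length w = depth C \<gamma>" "wa w \<gamma> \<in> neg_roots C"
    using depth_attained[OF r(2)] .
  have red: "reduced w"
    unfolding reduced_def using w depth_le by metis
  have "depth C \<alpha> < depth C \<gamma>"
  proof (cases "no_descent w i")
    case False
    then obtain w' where w': "wa w' = wa (w @ [i])" "length w' < length w"
      using not_no_descent[OF red] by metis
    have "wa w' \<alpha> = wa w \<gamma>" using w'(1) by (simp add: \<gamma>_def)
    then have "depth C \<alpha> \<le> length w'" using w(2) depth_le by metis
    with w' w show ?thesis by simp
  next
    case True
    have "wa w \<alpha> $ j \<le> 0" for j
    proof -
      have "wa w \<gamma> $ j = wa w \<alpha> $ j + c * wa w (sr i) $ j" by (simp add: \<gamma> wa_add wa_scale)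
      moreover have "wa w \<gamma> $ j \<le> 0" using w(2) by (simp add: neg_roots_iff)
      moreover have "0 \<le> c * wa w (sr i) $ j" using no_descent_positive[OF True] c by simp
      ultimately show ?thesis by linarith
    qed
    then have neg: "wa w \<alpha> \<in> neg_roots C" using r(1) by (simp add: neg_roots_iff roots_wa)
    have "w \<noteq> []" using w(2) pos pos_roots_not_neg by auto
    then obtain x u where xu: "w = x # u" by (cases w) auto
    \<comment> \<open>u is w without the letter that acts last; by minimality it leaves \<gamma>
      positive. If it also leaves \<alpha> positive, then x negates both images, so both are
      multiples of \<alpha>_x.\<close>
    have "wa u \<gamma> \<notin> neg_roots C" using depth_le[of u \<gamma>] w(1) xu by auto
    then have "wa u \<gamma> \<in> pos_roots C" using root_pos_or_neg roots_wa r(2) by blast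
    then obtain d where d: "d > 0" "wa u \<gamma> = d *\<^sub>R sr x"
      using pos_to_neg w(2) xu by auto
    show ?thesis
    proof (cases "wa u \<alpha> \<in> neg_roots C")
      case True
      from depth_le[OF this] w(1) xu show ?thesis by simp
    next
      case False
      then have "wa u \<alpha> \<in> pos_roots C" using root_pos_or_neg roots_wa r(1) by blast
      then obtain e where e: "e > 0" "wa u \<alpha> = e *\<^sub>R sr x"
        using pos_to_neg neg xu by auto
      have "wa u (e *\<^sub>R \<gamma>) = wa u (d *\<^sub>R \<alpha>)" by (simp add: wa_scale d e)
      then have "e *\<^sub>R \<gamma> = d *\<^sub>R \<alpha>" by (rule wa_inj)
      then have "(d - e) *\<^sub>R \<alpha> = (e * c) *\<^sub>R sr i" 
        unfolding \<gamma> by (simp add: algebra_simps)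
      then have "((d - e) *\<^sub>R \<alpha>) $ i = ((e * c) *\<^sub>R sr i) $ i" by (rule arg_cong)
      then have "(d - e) * \<alpha> $ i > 0" using e(1) c by (simp add: sr_nth)
      moreover have "\<alpha> $ i \<ge> 0" using assms(1) by (simp add: pos_roots_def)
      ultimately have de: "d - e > 0" by (metis mult_nonpos_nonneg not_le)
      \<comment> \<open>Now \<alpha> is a positive multiple of \<alpha>_i, whose pairing with i is 2
        > 0, against the hypothesis.\<close>
      have "(d - e) * pairing i \<alpha> = pairing i ((d - e) *\<^sub>R \<alpha>)"
        by (simp add: matrix_vector_mult_scaleR)
      also have "\<dots> = e * c * 2"
        unfolding \<open>(d - e) *\<^sub>R \<alpha> = (e * c) *\<^sub>R sr i\<close>
        by (simp add: matrix_vector_mult_scaleR pairing_sr C_diag)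
      finally have "(d - e) * pairing i \<alpha> > 0" using e(1) c by simp
      with de assms(2) show ?thesis by (simp add: zero_less_mult_iff)
    qed
  qed
  then show ?thesis by (simp add: \<gamma>_def)
qed

text \<open>A step raises coordinate i exactly when the pairing is negative, so the strict bound
  applies. Hence a chain from a simple root to \<beta> has exactly
  \<open>depth C \<beta> - 1\<close> steps.\<close>

lemma root_step_depth:
  assumes "root_step C \<beta> \<gamma>"
  shows "depth C \<gamma> = Suc (depth C \<beta>)"
proof -
  obtain i where i: "\<beta> \<in> pos_roots C" "\<gamma> = refl i \<beta>" "\<beta> $ i < \<gamma> $ i"
    using assms by (auto simp: root_step_def)
  then have "pairing i \<beta> < 0" by (simp add: refl_nth)
  from depth_less_refl[OF i(1) this] depth_refl_le[of \<beta> i] i show ?thesis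
    by (simp add: pos_roots_def)
qed

lemma root_le_rtranclp: "root_le C = (root_step C)\<^sup>*\<^sup>*"
  by (auto simp: fun_eq_iff root_le_def root_less_def dest: rtranclpD intro: tranclp_into_rtranclp)

section \<open>Games and chains of roots\<close>

lemma inner_fire: "\<beta> \<bullet> fire C i v = refl i \<beta> \<bullet> v"
proof -
  have "\<beta> \<bullet> fire C i v = \<beta> \<bullet> v - pairing i \<beta> * v $ i"
    by (simp add: fire_def inner_vec_def matrix_vector_mult_def right_diff_distrib sum_subtractf
        sum_distrib_left sum_distrib_right mult_ac)
  then show ?thesis
    by (simp add: refl_eq inner_diff_left simple_root_def inner_axis')
qed

lemma inner_sr: "sr i \<bullet> v = v $ i"
  by (simp add: simple_root_def inner_axis')

text \<open>This form shows the effect of skipping a reflection: only the signs of the coordinate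
  change and of v_i matter.\<close>

lemma inner_refl: "refl i \<beta> \<bullet> v = \<beta> \<bullet> v + (refl i \<beta> $ i - \<beta> $ i) * v $ i"
  by (simp add: refl_nth) (simp add: refl_eq inner_diff_left inner_sr)

lemma game_to_root:
  assumes "(legal_move C ^^ k) v w" "forbidden w"
  shows "\<exists>\<beta>\<in>pos_roots C. \<exists>i. \<beta> \<bullet> v < -1 \<and> root_le C (sr i) \<beta> \<and> depth C \<beta> \<le> Suc k"
  using assms
proof (induction k arbitrary: v)
  case 0
  then obtain i where "v $ i < -1" by (auto simp: forbidden_def)
  then show ?case
    by (intro bexI[of _ "sr i"] exI[of _ i]) (auto simp: inner_sr root_le_def depth_sr sr_pos_roots)
next
  case (Suc k)
  then obtain u where "legal_move C v u" "(legal_move C ^^ k) u w" by (blast dest: relpowp_Suc_D2)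
  then obtain i where i: "v $ i < 0" "u = fire C i v" by (auto simp: legal_move_def)
  from Suc.IH[OF \<open>(legal_move C ^^ k) u w\<close> Suc.prems(2)]
  obtain \<beta> j where \<beta>: "\<beta> \<in> pos_roots C" "\<beta> \<bullet> u < -1" "root_le C (sr j) \<beta>" "depth C \<beta> \<le> Suc k"
    by blast
  then have b: "refl i \<beta> \<bullet> v < -1" by (simp add: i inner_fire)
  show ?case
  proof (cases "\<beta> $ i < refl i \<beta> $ i")
    case True
    have \<beta>r: "\<beta> \<in> roots C" using \<beta>(1) by (simp add: pos_roots_def)
    have "0 \<le> \<beta> $ j" for j using \<beta>(1) by (simp add: pos_roots_def)
    \<comment> \<open>Only coordinate i moves, and it increases.\<close>
    then have "0 \<le> refl i \<beta> $ j" for j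
      using True by (cases "j = i") (auto simp: refl_nth intro: order_trans less_imp_le)
    then have pos: "refl i \<beta> \<in> pos_roots C"
      using roots_wa[OF \<beta>r, of "[i]"] by (simp add: pos_roots_def)
    then have "root_step C \<beta> (refl i \<beta>)" using \<beta>(1) True by (auto simp: root_step_def)
    then have "root_le C (sr j) (refl i \<beta>)" using \<beta>(3) by (simp add: root_le_rtranclp)
    then show ?thesis using pos b depth_refl_le[OF \<beta>r, of i] \<beta>(4)
      by (intro bexI[of _ "refl i \<beta>"] exI[of _ j]) auto
  next
    case False
    \<comment> \<open>Both factors are nonpositive, so \<beta> itself already satisfies the bound at
      v and is kept in place of its reflection.\<close>
    then have "0 \<le> (refl i \<beta> $ i - \<beta> $ i) * v $ i"
      using i(1) by (intro mult_nonpos_nonpos) auto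
    then have "\<beta> \<bullet> v < -1" using b inner_refl[of i \<beta> v] by linarith
    with \<beta> show ?thesis by (intro bexI[of _ \<beta>] exI[of _ j]) auto
  qed
qed

text \<open>Each step down the chain costs at most one move, and the simple root at the bottom has
  depth 1 and needs none; hence the strict inequality.\<close>

lemma root_to_game:
  assumes "root_le C (sr i) \<beta>" "\<beta> \<bullet> v < -1"
  shows "\<exists>k w. k < depth C \<beta> \<and> (legal_move C ^^ k) v w \<and> forbidden w"
  using assms unfolding root_le_rtranclp
proof (induction arbitrary: v rule: rtranclp_induct)
  case base
  then have "forbidden v" by (auto simp: forbidden_def inner_sr)
  then show ?case by (intro exI[of _ 0] exI[of _ v]) (auto simp: depth_sr)
next
  case (step \<beta> \<gamma>)
  obtain j where j: "\<gamma> = refl j \<beta>" "\<beta> $ j < \<gamma> $ j"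
    using step.hyps(2) by (auto simp: root_step_def)
  have dp: "depth C \<gamma> = Suc (depth C \<beta>)" using root_step_depth step.hyps(2) .
  show ?case
  proof (cases "v $ j < 0")
    case True
    have "\<beta> \<bullet> fire C j v < -1" using step.prems by (simp add: inner_fire j)
    from step.IH[OF this] obtain k w where k: "k < depth C \<beta>"
      "(legal_move C ^^ k) (fire C j v) w" "forbidden w" by blast
    have "legal_move C v (fire C j v)" using True by (auto simp: legal_move_def)
    then have "(legal_move C ^^ Suc k) v w" using k(2) by (rule relpowp_Suc_I2)
    with k dp show ?thesis by (intro exI[of _ "Suc k"] exI[of _ w]) auto
  next
    case False
    \<comment> \<open>Here j cannot be fired, but the smaller root \<beta> satisfies the bound at
      the same v, so the chain is shortened without a move.\<close>
    then have "0 \<le> (\<gamma> $ j - \<beta> $ j) * v $ j" using j(2) by simp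
    then have "\<beta> \<bullet> v < -1" using step.prems inner_refl[of j \<beta> v] unfolding j(1) by linarith
    from step.IH[OF this] dp show ?thesis using less_SucI by metis
  qed
qed

section \<open>Reachability and the minimum number of moves\<close>

lemma reach_iff:
  "can_reach_forbidden C v \<longleftrightarrow> (\<exists>k w. (legal_move C ^^ k) v w \<and> forbidden w)"
  by (auto simp: can_reach_forbidden_def rtranclp_power)

lemma reach_iff_root:
  "can_reach_forbidden C v \<longleftrightarrow> (\<exists>\<beta>\<in>pos_roots C. \<exists>i. \<beta> \<bullet> v < -1 \<and> root_le C (sr i) \<beta>)"
  unfolding reach_iff using game_to_root root_to_game by metis

lemma min_moves_attained:
  assumes "can_reach_forbidden C v"
  shows "\<exists>w. (legal_move C ^^ min_moves_to_forbidden C v) v w \<and> forbidden w"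
  using assms unfolding reach_iff min_moves_to_forbidden_def by (rule LeastI_ex)

lemma min_moves_le:
  "(legal_move C ^^ k) v w \<Longrightarrow> forbidden w \<Longrightarrow> min_moves_to_forbidden C v \<le> k"
  unfolding min_moves_to_forbidden_def by (rule Least_le) blast

text \<open>A root attaining \<open>min_depth\<close> yields a game of at most that many moves;
  conversely a shortest game of k moves yields an admissible root of depth at most k + 1.\<close>

lemma min_moves_eq_min_depth:
  assumes "can_reach_forbidden C v"
  shows "min_moves_to_forbidden C v = min_depth C v"
proof -
  let ?S = "{depth C \<beta> - 1 | \<beta>. \<beta> \<in> pos_roots C \<and> \<beta> \<bullet> v < -1 \<and> (\<exists>i. root_le C (sr i) \<beta>)}"
  have "\<exists>m. m \<in> ?S" using assms unfolding reach_iff_root by blast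
  then have "min_depth C v \<in> ?S" unfolding min_depth_def by (rule LeastI_ex)
  then obtain \<beta> i where \<beta>: "min_depth C v = depth C \<beta> - 1" "\<beta> \<bullet> v < -1" "root_le C (sr i) \<beta>"
    by blast
  obtain k w where "k < depth C \<beta>" "(legal_move C ^^ k) v w" "forbidden w"
    using root_to_game[OF \<beta>(3,2)] by blast
  then have "min_moves_to_forbidden C v \<le> min_depth C v"
    using min_moves_le[of k v w] \<beta>(1) by simp
  moreover obtain w' where "(legal_move C ^^ min_moves_to_forbidden C v) v w'" "forbidden w'"
    using min_moves_attained[OF assms] by blast
  from game_to_root[OF this] obtain \<gamma> j where \<gamma>: "\<gamma> \<in> pos_roots C" "\<gamma> \<bullet> v < -1"
    "root_le C (sr j) \<gamma>" "depth C \<gamma> \<le> Suc (min_moves_to_forbidden C v)" by blast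
  then have "depth C \<gamma> - 1 \<in> ?S" by blast
  then have "min_depth C v \<le> depth C \<gamma> - 1" unfolding min_depth_def by (rule Least_le)
  ultimately show ?thesis using \<gamma>(4) by simp
qed

text \<open>Firing i and then playing an optimal game from \<open>fire C i v\<close> is one
  particular game from v.\<close>

lemma min_moves_fire:
  assumes "v $ i < 0" "can_reach_forbidden C (fire C i v)"
  shows "min_moves_to_forbidden C v \<le> Suc (min_moves_to_forbidden C (fire C i v))"
proof -
  obtain w where w: "(legal_move C ^^ min_moves_to_forbidden C (fire C i v)) (fire C i v) w"
    "forbidden w"
    using min_moves_attained[OF assms(2)] by blast
  have "legal_move C v (fire C i v)" using assms(1) by (auto simp: legal_move_def)
  from min_moves_le[OF relpowp_Suc_I2[OF this w(1)] w(2)] show ?thesis .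
qed

end

theorem theorem5p7:
  fixes adj :: "'i::finite \<Rightarrow> 'i \<Rightarrow> bool"
    and n :: "'i \<Rightarrow> 'i \<Rightarrow> enat"
    and C :: "real ^ 'i ^ 'i"
    and v :: "real ^ 'i"
  assumes "weighted_coxeter_graph adj n C"
  shows "(can_reach_forbidden C v \<longleftrightarrow>
            (\<exists>\<beta>\<in>pos_roots C. \<exists>i. \<beta> \<bullet> v < -1 \<and> root_le C (simple_root i) \<beta>)) \<and>
         (can_reach_forbidden C v \<longrightarrow>
            min_moves_to_forbidden C v = min_depth C v \<and>
            (\<forall>i. v $ i < 0 \<and> can_reach_forbidden C (fire C i v) \<longrightarrow>
               int (min_depth C (fire C i v)) \<ge> int (min_depth C v) - 1))"
proof -
  interpret weighted_coxeter_graph adj n C by fact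
  have "int (min_depth C v) - 1 \<le> int (min_depth C (fire C i v))"
    if "can_reach_forbidden C v" "v $ i < 0" "can_reach_forbidden C (fire C i v)" for i
    using min_moves_fire[OF that(2,3)] min_moves_eq_min_depth[OF that(1)]
      min_moves_eq_min_depth[OF that(3)] by simp
  then show ?thesis
    using reach_iff_root[of v] min_moves_eq_min_depth[of v] by blast
qed

end
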